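(* Let $m$ be an integer and $n$ a positive integer. Let $Q_{m,n}$ be the set of doubly marked partitions of $n$ with spt-crank $m$, and let $V_{m,n}$ be the set of pairs of partitions $(\alpha,\beta)$ with $|\alpha|+|\beta|=n$, all parts of $\beta$ equal, such that (1) the rank-set of $\alpha$ contains $m$, and (2) if $j$ is the width of the $m$-Durfee rectangle of $\alpha$ and $h$ is the maximum integer with $\alpha_{j+m+1+h}\ge h$, then $\beta_1=j+m+1+h$. For $(\lambda,s,t)\in Q_{m,n}$ with $\lambda=(\lambda_1,\dots,\lambda_\ell)$ define $\psi(\lambda,s,t)=(\alpha,\beta)$ by $$\alpha=(\lambda_1-t+s-1,\ \dots,\ \lambda_{\lambda'_s}-t+s-1,\ \lambda_{\lambda'_s+1},\ \dots,\ \lambda_\ell),\qquad \beta=(\lambda'_s,\lambda'_{s+1},\dots,\lambda'_t).$$ Then $\psi$ is a bijection from $Q_{m,n}$ onto $V_{m,n}$.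
   Context: Partitions are written with weakly decreasing parts, with $\alpha_i=0$ for $i$ larger than the number of parts; $\lambda'$ is the conjugate of $\lambda$ (so $\lambda'_s$ is the number of parts of $\lambda$ that are $\ge s$), and $D(\lambda)$ is the side length of the Durfee square. A doubly marked partition of $n$ is a triple $(\lambda,s,t)$ with $\lambda$ a partition of $n$, $1\le s\le D(\lambda)$, $s\le t\le\lambda_1$, and $\lambda'_s=\lambda'_t$; with $g=\lambda'_s-s+1$, its spt-crank is $g-\lambda_g+t-s$. The rank-set of $\alpha=(\alpha_1,\dots,\alpha_\ell)$ is the sequence $[-\alpha_1,\,1-\alpha_2,\,\dots,\,\ell-1-\alpha_\ell,\,\ell,\,\ell+1,\dots]$. For an integer $m$ (possibly negative), the $m$-Durfee rectangle of $\alpha$ is the largest $(m+j)\times j$ rectangle ($m+j$ rows, $j$ columns) contained in the Ferrers diagram of $\alpha$, and $j$ is its width; if $\ell(\alpha)\le m$ the width is taken to be $0$. *)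

theory Defs
  imports Main
begin

text \<open>
  A partition is the list of its parts: positive, in weakly decreasing order.
\<close>

definition is_partition :: "nat list \<Rightarrow> bool" where
  "is_partition xs \<longleftrightarrow> sorted_wrt (\<ge>) xs \<and> (\<forall>x\<in>set xs. 0 < x)"

text \<open>Parts are numbered from 1; \<open>part \<alpha> i = 0\<close> when \<open>i\<close> exceeds the number of parts.\<close>

definition part :: "nat list \<Rightarrow> nat \<Rightarrow> nat" where
  "part \<alpha> i = (if 1 \<le> i \<and> i \<le> length \<alpha> then \<alpha> ! (i - 1) else 0)"

definition conj_part :: "nat list \<Rightarrow> nat \<Rightarrow> nat" where
  "conj_part \<alpha> s = card {i \<in> {1..length \<alpha>}. s \<le> part \<alpha> i}"

definition ferrers :: "nat list \<Rightarrow> (nat \<times> nat) set" where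
  "ferrers \<alpha> = {(i, c). 1 \<le> i \<and> i \<le> length \<alpha> \<and> 1 \<le> c \<and> c \<le> part \<alpha> i}"

definition durfee_set :: "nat list \<Rightarrow> nat set" where
  "durfee_set \<alpha> = {d. {1..d} \<times> {1..d} \<subseteq> ferrers \<alpha>}"

definition durfee :: "nat list \<Rightarrow> nat" where
  "durfee \<alpha> = Max (durfee_set \<alpha>)"

definition doubly_marked :: "nat \<Rightarrow> nat list \<times> nat \<times> nat \<Rightarrow> bool" where
  "doubly_marked n = (\<lambda>(l, s, t).
     is_partition l \<and> sum_list l = n \<and>
     1 \<le> s \<and> s \<le> durfee l \<and> s \<le> t \<and> t \<le> part l 1 \<and>
     conj_part l s = conj_part l t)"

text \<open>For a doubly marked partition, \<open>s \<le> durfee l\<close> gives \<open>s \<le> conj_part l s\<close>, so the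
  subtraction defining \<open>g\<close> is not truncated.\<close>

definition spt_crank :: "nat list \<times> nat \<times> nat \<Rightarrow> int" where
  "spt_crank = (\<lambda>(l, s, t).
     let g = conj_part l s - s + 1 in int g - int (part l g) + int t - int s)"

definition Q :: "int \<Rightarrow> nat \<Rightarrow> (nat list \<times> nat \<times> nat) set" where
  "Q m n = {x. doubly_marked n x \<and> spt_crank x = m}"

text \<open>With rows numbered from 1, row \<open>Suc i\<close> contributes \<open>i - part \<alpha> (Suc i)\<close>, which is
  \<open>i\<close> beyond the last part.\<close>

definition rank_set :: "nat list \<Rightarrow> int set" where
  "rank_set \<alpha> = range (\<lambda>i. int i - int (part \<alpha> (Suc i)))"

text \<open>
  Rectangles may have no rows or no columns; thus for negative \<open>m\<close> the width is at least \<open>-m\<close>,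
  the value \<open>-m\<close> belonging to a rectangle with no rows.
\<close>

definition rect_widths :: "int \<Rightarrow> nat list \<Rightarrow> nat set" where
  "rect_widths m \<alpha> =
     {j. 0 \<le> m + int j \<and> {1..nat (m + int j)} \<times> {1..j} \<subseteq> ferrers \<alpha>}"

definition durfee_width :: "int \<Rightarrow> nat list \<Rightarrow> nat" where
  "durfee_width m \<alpha> = (if int (length \<alpha>) \<le> m then 0 else Max (rect_widths m \<alpha>))"

text \<open>The integers \<open>h\<close> for which \<open>j + m + 1 + h\<close> is a row index with
  \<open>\<alpha>\<^bsub>j+m+1+h\<^esub> \<ge> h\<close>, where \<open>j\<close> is the width of the \<open>m\<close>-Durfee rectangle.\<close>

definition shift_set :: "int \<Rightarrow> nat list \<Rightarrow> int set" where
  "shift_set m \<alpha> =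
     {h. let i = int (durfee_width m \<alpha>) + m + 1 + h in 1 \<le> i \<and> h \<le> int (part \<alpha> (nat i))}"

definition V :: "int \<Rightarrow> nat \<Rightarrow> (nat list \<times> nat list) set" where
  "V m n = {(\<alpha>, \<beta>).
     is_partition \<alpha> \<and> is_partition \<beta> \<and> sum_list \<alpha> + sum_list \<beta> = n \<and>
     (\<forall>x\<in>set \<beta>. \<forall>y\<in>set \<beta>. x = y) \<and>
     m \<in> rank_set \<alpha> \<and>
     int (part \<beta> 1) = int (durfee_width m \<alpha>) + m + 1 + Max (shift_set m \<alpha>)}"

text \<open>
  The first \<open>conj_part l s = conj_part l t\<close> parts of \<open>l\<close> are at least \<open>t\<close>, and \<open>s \<ge> 1\<close>, so
  \<open>part l i - t + s - 1\<close> is not truncated on doubly marked partitions. It is zero when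
  \<open>s = 1\<close> and \<open>part l i = t\<close>; such trailing zeros are not parts and are dropped.
\<close>

definition psi :: "nat list \<times> nat \<times> nat \<Rightarrow> nat list \<times> nat list" where
  "psi = (\<lambda>(l, s, t).
     (filter (\<lambda>x. 0 < x)
        (map (\<lambda>i. part l i - t + s - 1) [1..<Suc (conj_part l s)] @
         map (part l) [Suc (conj_part l s)..<Suc (length l)]),
      map (conj_part l) [s..<Suc t]))"

text \<open>The maxima above are taken over finite nonempty sets.\<close>

lemma durfee_set_finite_nonempty: "finite (durfee_set \<alpha>) \<and> durfee_set \<alpha> \<noteq> {}"
proof
  have "durfee_set \<alpha> \<subseteq> {..length \<alpha>}"
  proof
    fix d assume d: "d \<in> durfee_set \<alpha>"
    show "d \<in> {..length \<alpha>}"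
    proof (cases "d = 0")
      case False
      then have "(d, d) \<in> {1..d} \<times> {1..d}" by simp
      then have "(d, d) \<in> ferrers \<alpha>" using d by (auto simp only: durfee_set_def)
      then show ?thesis by (simp add: ferrers_def)
    qed simp
  qed
  then show "finite (durfee_set \<alpha>)" by (rule finite_subset) simp
  have "0 \<in> durfee_set \<alpha>" by (simp add: durfee_set_def)
  then show "durfee_set \<alpha> \<noteq> {}" by blast
qed

lemma rect_widths_finite_nonempty: "finite (rect_widths m \<alpha>) \<and> rect_widths m \<alpha> \<noteq> {}"
proof
  have "rect_widths m \<alpha> \<subseteq> {..nat (- m) + part \<alpha> 1}"
  proof
    fix j assume j: "j \<in> rect_widths m \<alpha>"
    show "j \<in> {..nat (- m) + part \<alpha> 1}"
    proof (cases "1 \<le> j \<and> 1 \<le> m + int j")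
      case True
      then have "(1, j) \<in> {1..nat (m + int j)} \<times> {1..j}" by auto
      then have "(1, j) \<in> ferrers \<alpha>" using j by (auto simp only: rect_widths_def)
      then show ?thesis by (simp add: ferrers_def)
    qed auto
  qed
  then show "finite (rect_widths m \<alpha>)" by (rule finite_subset) simp
  have "nat (- m) \<in> rect_widths m \<alpha>" by (auto simp: rect_widths_def)
  then show "rect_widths m \<alpha> \<noteq> {}" by blast
qed

lemma shift_set_finite_nonempty: "finite (shift_set m \<alpha>) \<and> shift_set m \<alpha> \<noteq> {}"
proof
  let ?j = "int (durfee_width m \<alpha>)"
  have le: "part \<alpha> i \<le> sum_list \<alpha>" for i
    by (auto simp: part_def intro: member_le_sum_list)
  have "shift_set m \<alpha> \<subseteq> {- (?j + m)..int (sum_list \<alpha>)}"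
  proof
    fix h assume "h \<in> shift_set m \<alpha>"
    then have "1 \<le> ?j + m + 1 + h" "h \<le> int (part \<alpha> (nat (?j + m + 1 + h)))"
      by (simp_all add: shift_set_def Let_def)
    then show "h \<in> {- (?j + m)..int (sum_list \<alpha>)}"
      using le[of "nat (?j + m + 1 + h)"] by simp
  qed
  then show "finite (shift_set m \<alpha>)" by (rule finite_subset) simp
  have "0 \<le> m + ?j"
    using Max_in[of "rect_widths m \<alpha>"] rect_widths_finite_nonempty[of m \<alpha>]
    by (auto simp: durfee_width_def rect_widths_def)
  then have "0 \<in> shift_set m \<alpha>" by (simp add: shift_set_def Let_def)
  then show "shift_set m \<alpha> \<noteq> {}" by blast
qed

end

theory Submission
  imports Defs
begin

text \<open>
  Put \<open>k = \<lambda>'\<^sub>s\<close>, \<open>g = k - s + 1\<close> and \<open>r = t - s + 1\<close>. Then \<open>\<psi>\<close> removes \<open>r\<close> columns of height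
  \<open>k\<close> from \<open>\<lambda>\<close>, and the marks survive as the inequalities
  \<open>\<alpha>\<^bsub>k+1\<^esub> \<le> s - 1 \<le> \<alpha>\<^sub>k\<close>. The spt-crank becomes \<open>g - 1 - \<alpha>\<^sub>g\<close>, an element of the rank-set,
  and \<open>g\<close> is recovered from \<open>m\<close> because \<open>i - \<alpha>\<^bsub>i+1\<^esub>\<close> is strictly increasing in \<open>i\<close>.
  The \<open>m\<close>-Durfee rectangle then has \<open>g - 1\<close> rows and width \<open>\<alpha>\<^sub>g\<close>, and the two inequalities
  say exactly that the maximal shift is \<open>h = s - 1\<close>, that is \<open>k = g + h\<close>.
\<close>

section \<open>Parts, lengths and sums of partitions\<close>

lemma part_antimono:
  assumes "is_partition \<alpha>" "1 \<le> i" "i \<le> i'"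
  shows "part \<alpha> i' \<le> part \<alpha> i"
proof (cases "i < i' \<and> i' \<le> length \<alpha>")
  case True
  then have "i - 1 < i' - 1" "i' - 1 < length \<alpha>" using assms by auto
  then have "\<alpha> ! (i - 1) \<ge> \<alpha> ! (i' - 1)"
    using assms(1) sorted_wrt_nth_less[of "(\<ge>)" \<alpha> "i - 1" "i' - 1"]
    by (simp add: is_partition_def)
  with True assms show ?thesis by (simp add: part_def)
next
  case False
  with assms show ?thesis by (cases "i = i'") (auto simp: part_def)
qed

lemma part_pos_iff:
  assumes "is_partition \<alpha>" "1 \<le> i"
  shows "0 < part \<alpha> i \<longleftrightarrow> i \<le> length \<alpha>"
  using assms by (auto simp: part_def is_partition_def)

lemma partition_eqI:
  assumes "is_partition \<alpha>" "is_partition \<gamma>" "\<And>i. 1 \<le> i \<Longrightarrow> part \<alpha> i = part \<gamma> i"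
  shows "\<alpha> = \<gamma>"
proof (rule nth_equalityI)
  have "i \<le> length \<alpha> \<longleftrightarrow> i \<le> length \<gamma>" if "1 \<le> i" for i
    using part_pos_iff[OF assms(1) that] part_pos_iff[OF assms(2) that] assms(3)[OF that] by simp
  from this[of "length \<alpha>"] this[of "length \<gamma>"] show len: "length \<alpha> = length \<gamma>"
    by (cases "length \<alpha>"; cases "length \<gamma>") auto
  fix i assume "i < length \<alpha>"
  with assms(3)[of "Suc i"] len show "\<alpha> ! i = \<gamma> ! i" by (simp add: part_def)
qed

text \<open>The free bound \<open>N\<close> allows partitions of different lengths to be summed over
  one index range; the extra terms are zero.\<close>

lemma sum_list_eq_sum_part:
  assumes "length \<alpha> \<le> N"
  shows "sum_list \<alpha> = (\<Sum>i=1..N. part \<alpha> i)"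
proof -
  have "sum_list \<alpha> = (\<Sum>i<length \<alpha>. part \<alpha> (Suc i))"
    by (simp add: sum_list_sum_nth part_def atLeast0LessThan)
  also have "\<dots> = (\<Sum>i<N. part \<alpha> (Suc i))"
    using assms by (intro sum.mono_neutral_left) (auto simp: part_def)
  also have "\<dots> = (\<Sum>i=1..N. part \<alpha> i)"
    by (rule sum.reindex_bij_witness[of _ "\<lambda>i. i - 1" Suc]) auto
  finally show ?thesis .
qed

section \<open>Partitions built from weakly decreasing functions\<close>

definition parts_of :: "(nat \<Rightarrow> nat) \<Rightarrow> nat \<Rightarrow> nat list" where
  "parts_of f N = filter (\<lambda>x. 0 < x) (map f [1..<Suc N])"

lemma is_partition_parts_of:
  assumes "\<And>i i'. 1 \<le> i \<Longrightarrow> i \<le> i' \<Longrightarrow> i' \<le> N \<Longrightarrow> f i' \<le> f i"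
  shows "is_partition (parts_of f N)"
proof -
  have "sorted_wrt (\<lambda>i i'. f i' \<le> f i) [1..<Suc N]"
    using assms by (intro sorted_wrt_mono_rel[OF _ sorted_wrt_upt]) (auto simp: Suc_le_eq)
  then show ?thesis
    by (auto simp: is_partition_def parts_of_def sorted_wrt_map simp del: upt_Suc
        intro!: sorted_wrt_filter)
qed

text \<open>Monotonicity pushes the zeros of \<open>f\<close> to the end, so the filter shifts no
  index. In the induction either the last value is zero and gets dropped, or all values are positive
  and the filter keeps everything.\<close>

lemma part_parts_of:
  assumes "\<And>i i'. 1 \<le> i \<Longrightarrow> i \<le> i' \<Longrightarrow> i' \<le> N \<Longrightarrow> f i' \<le> f i"
  shows "part (parts_of f N) i = (if 1 \<le> i \<and> i \<le> N then f i else 0)"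
  using assms
proof (induction N)
  case 0
  show ?case by (simp add: parts_of_def part_def)
next
  case (Suc N)
  show ?case
  proof (cases "f (Suc N) = 0")
    case True
    then have "parts_of f (Suc N) = parts_of f N" by (simp add: parts_of_def)
    with Suc True show ?thesis by (auto simp: le_Suc_eq)
  next
    case False
    then have "0 < f i" if "1 \<le> i" "i \<le> Suc N" for i
      using Suc.prems[of i "Suc N"] that by simp
    then have "parts_of f (Suc N) = map f [1..<Suc (Suc N)]"
      unfolding parts_of_def by (intro filter_True) (auto simp del: upt_Suc)
    then show ?thesis by (auto simp: part_def simp del: upt_Suc)
  qed
qed

section \<open>Conjugate partition and Durfee square\<close>

lemma le_conj_part_iff:
  assumes "is_partition \<mu>" "1 \<le> s" "1 \<le> i"
  shows "i \<le> conj_part \<mu> s \<longleftrightarrow> s \<le> part \<mu> i"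
proof -
  let ?S = "{i \<in> {1..length \<mu>}. s \<le> part \<mu> i}"
  have fin: "finite ?S" by simp
  show ?thesis
  proof
    \<comment> \<open>Rows of length at least \<open>s\<close> form an initial segment; since
      \<open>s \<ge> 1\<close>, row \<open>i\<close> is a genuine row and the segment contains
      \<open>{1..i}\<close>.\<close>
    assume "s \<le> part \<mu> i"
    then have "{1..i} \<subseteq> ?S"
      using part_antimono[OF assms(1)] assms(2,3) part_pos_iff[OF assms(1,3)]
      by (auto intro: order_trans)
    from card_mono[OF fin this] show "i \<le> conj_part \<mu> s" by (simp add: conj_part_def)
  next
    assume i: "i \<le> conj_part \<mu> s"
    show "s \<le> part \<mu> i"
    proof (rule ccontr)
      assume neg: "\<not> s \<le> part \<mu> i"
      have "?S \<subseteq> {1..<i}"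
      proof
        fix x assume "x \<in> ?S"
        with neg part_antimono[OF assms(1,3), of x] show "x \<in> {1..<i}"
          by (cases "i \<le> x") auto
      qed
      from card_mono[OF _ this] assms(3) i show False by (simp add: conj_part_def)
    qed
  qed
qed

lemma conj_part_eqI:
  assumes "is_partition \<mu>" "1 \<le> s" "1 \<le> k" "s \<le> part \<mu> k" "part \<mu> (Suc k) < s"
  shows "conj_part \<mu> s = k"
  using le_conj_part_iff[OF assms(1,2,3)] le_conj_part_iff[OF assms(1,2), of "Suc k"] assms(4,5)
  by simp

text \<open>Rows above row \<open>d\<close> are no shorter, so the square fits as soon as its corner
  cell \<open>(d, d)\<close> lies in the diagram.\<close>

lemma le_durfee_iff:
  assumes "is_partition \<mu>" "1 \<le> d"
  shows "d \<le> durfee \<mu> \<longleftrightarrow> d \<le> part \<mu> d"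
proof
  assume "d \<le> part \<mu> d"
  moreover from this have "d \<le> length \<mu>" using part_pos_iff[OF assms] assms(2) by simp
  ultimately have "d \<in> durfee_set \<mu>"
    using part_antimono[OF assms(1), of _ d] by (force simp: durfee_set_def ferrers_def)
  then show "d \<le> durfee \<mu>"
    using durfee_set_finite_nonempty by (simp add: durfee_def)
next
  assume d: "d \<le> durfee \<mu>"
  have "durfee \<mu> \<in> durfee_set \<mu>"
    unfolding durfee_def using durfee_set_finite_nonempty by (intro Max_in) auto
  moreover have "(d, d) \<in> {1..durfee \<mu>} \<times> {1..durfee \<mu>}" using d assms(2) by simp
  ultimately have "(d, d) \<in> ferrers \<mu>" by (auto simp only: durfee_set_def)
  then show "d \<le> part \<mu> d" by (simp add: ferrers_def)
qed

section \<open>Rank-set, m-Durfee rectangle and maximal shift\<close>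

lemma crank_index_unique:
  assumes "is_partition \<alpha>" "1 \<le> g" "1 \<le> g'"
    "int g - 1 - int (part \<alpha> g) = int g' - 1 - int (part \<alpha> g')"
  shows "g = g'"
  using part_antimono[OF assms(1,2), of g'] part_antimono[OF assms(1,3), of g] assms(4)
  by (cases "g \<le> g'") auto

lemma rank_set_iff:
  "m \<in> rank_set \<alpha> \<longleftrightarrow> (\<exists>g\<ge>1. m = int g - 1 - int (part \<alpha> g))"
proof
  assume "m \<in> rank_set \<alpha>"
  then obtain i where "m = int i - int (part \<alpha> (Suc i))" by (auto simp: rank_set_def)
  then show "\<exists>g\<ge>1. m = int g - 1 - int (part \<alpha> g)" by (intro exI[of _ "Suc i"]) simp
next
  assume "\<exists>g\<ge>1. m = int g - 1 - int (part \<alpha> g)"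
  then obtain g where "1 \<le> g" "m = int g - 1 - int (part \<alpha> g)" by blast
  then show "m \<in> rank_set \<alpha>"
    unfolding rank_set_def by (intro image_eqI[of _ _ "g - 1"]) auto
qed

text \<open>The value of \<open>m\<close> fixes rows minus columns at
  \<open>g - 1 - part \<alpha> g\<close>. A rectangle of \<open>g - 1\<close> rows and
  \<open>part \<alpha> g\<close> columns fits because the rows above row \<open>g\<close> are no
  shorter; any wider one also has a row \<open>g\<close>, which is too short for it.\<close>

lemma durfee_width_eq:
  assumes "is_partition \<alpha>" "1 \<le> g" and m: "m = int g - 1 - int (part \<alpha> g)"
  shows "durfee_width m \<alpha> = part \<alpha> g"
proof (cases "int (length \<alpha>) \<le> m")
  case True
  \<comment> \<open>Since \<open>m \<le> g - 1\<close>, row \<open>g\<close> lies past the end and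
    has length 0, which agrees with the conventional width 0.\<close>
  with m have "\<not> g \<le> length \<alpha>" by linarith
  with True show ?thesis by (simp add: durfee_width_def part_def)
next
  case False
  have "Max (rect_widths m \<alpha>) = part \<alpha> g"
  proof (rule Max_eqI)
    show "finite (rect_widths m \<alpha>)" using rect_widths_finite_nonempty by blast
    have "(i, c) \<in> ferrers \<alpha>" if "1 \<le> i" "i \<le> g - 1" "1 \<le> c" "c \<le> part \<alpha> g" for i c
    proof -
      have "c \<le> part \<alpha> i" using that part_antimono[OF assms(1) that(1), of g] by linarith
      with that part_pos_iff[OF assms(1) that(1)] show ?thesis by (simp add: ferrers_def)
    qed
    moreover have "nat (m + int (part \<alpha> g)) = g - 1" using m assms(2) by simp
    ultimately show "part \<alpha> g \<in> rect_widths m \<alpha>"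
      using m assms(2) by (auto simp: rect_widths_def)
    fix j assume j: "j \<in> rect_widths m \<alpha>"
    show "j \<le> part \<alpha> g"
    proof (rule ccontr)
      assume "\<not> j \<le> part \<alpha> g"
      with m assms(2) have "(g, Suc (part \<alpha> g)) \<in> {1..nat (m + int j)} \<times> {1..j}" by auto
      with j have "(g, Suc (part \<alpha> g)) \<in> ferrers \<alpha>" by (auto simp only: rect_widths_def)
      then show False by (simp add: ferrers_def)
    qed
  qed
  with False show ?thesis by (simp add: durfee_width_def)
qed

text \<open>The row index in \<open>shift_set\<close> is \<open>g + h\<close>. As \<open>h\<close>
  grows the bound \<open>part \<alpha> (g + h)\<close> cannot increase, so once \<open>h + 1\<close>
  fails every larger value fails: testing \<open>h\<close> and \<open>h + 1\<close> determines the
  maximum.\<close>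

lemma Max_shift_set_iff:
  assumes "is_partition \<alpha>" "1 \<le> g" and m: "m = int g - 1 - int (part \<alpha> g)"
  shows "Max (shift_set m \<alpha>) = int h \<longleftrightarrow> h \<le> part \<alpha> (g + h) \<and> part \<alpha> (Suc (g + h)) \<le> h"
proof -
  have S: "shift_set m \<alpha> = {x. 1 \<le> int g + x \<and> x \<le> int (part \<alpha> (nat (int g + x)))}"
    unfolding shift_set_def durfee_width_eq[OF assms] Let_def by (simp add: m)
  note fin = shift_set_finite_nonempty[of m \<alpha>]
  have mem: "int x \<in> shift_set m \<alpha> \<longleftrightarrow> x \<le> part \<alpha> (g + x)" for x
    using assms(2) by (simp add: S nat_int_add)
  show ?thesis
  proof
    assume h: "Max (shift_set m \<alpha>) = int h"
    then have "int h \<in> shift_set m \<alpha>" using Max_in fin by metis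
    moreover have "int (Suc h) \<notin> shift_set m \<alpha>"
    proof
      assume "int (Suc h) \<in> shift_set m \<alpha>"
      with fin have "int (Suc h) \<le> Max (shift_set m \<alpha>)" by (intro Max_ge) auto
      with h show False by simp
    qed
    ultimately show "h \<le> part \<alpha> (g + h) \<and> part \<alpha> (Suc (g + h)) \<le> h"
      unfolding mem by simp
  next
    assume h: "h \<le> part \<alpha> (g + h) \<and> part \<alpha> (Suc (g + h)) \<le> h"
    show "Max (shift_set m \<alpha>) = int h"
    proof (rule Max_eqI)
      show "finite (shift_set m \<alpha>)" using fin by blast
      show "int h \<in> shift_set m \<alpha>" using h mem by blast
      fix x assume x: "x \<in> shift_set m \<alpha>"
      show "x \<le> int h"
      proof (rule ccontr)
        assume neg: "\<not> x \<le> int h"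
        define y where "y = nat x"
        have xy: "x = int y" "h < y" using neg by (auto simp: y_def)
        then have "y \<le> part \<alpha> (g + y)" using x mem by blast
        also have "\<dots> \<le> part \<alpha> (Suc (g + h))"
          using xy by (intro part_antimono assms) auto
        finally show False using h xy by simp
      qed
    qed
  qed
qed

text \<open>This makes the maximal shift a natural number, as \<open>Max_shift_set_iff\<close>
  requires.\<close>

lemma Max_shift_set_nonneg:
  assumes "is_partition \<alpha>" "1 \<le> g" "m = int g - 1 - int (part \<alpha> g)"
  shows "0 \<le> Max (shift_set m \<alpha>)"
proof (intro Max_ge)
  show "finite (shift_set m \<alpha>)" using shift_set_finite_nonempty by blast
  show "0 \<in> shift_set m \<alpha>"
    unfolding shift_set_def durfee_width_eq[OF assms] Let_def using assms(2,3) by simp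
qed

section \<open>Common parameters g, h, r for both sides\<close>

lemma V_iff:
  "(\<alpha>, \<beta>) \<in> V m n \<longleftrightarrow>
    is_partition \<alpha> \<and>
    (\<exists>g h r. 1 \<le> g \<and> 1 \<le> r \<and> m = int g - 1 - int (part \<alpha> g) \<and>
      h \<le> part \<alpha> (g + h) \<and> part \<alpha> (Suc (g + h)) \<le> h \<and>
      \<beta> = replicate r (g + h) \<and> sum_list \<alpha> + r * (g + h) = n)"
  (is "?L \<longleftrightarrow> is_partition \<alpha> \<and> ?R")
proof
  assume V: ?L
  then have \<alpha>: "is_partition \<alpha>" and \<beta>: "\<forall>x\<in>set \<beta>. \<forall>y\<in>set \<beta>. x = y"
    and n: "sum_list \<alpha> + sum_list \<beta> = n" and "m \<in> rank_set \<alpha>"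
    and \<beta>1: "int (part \<beta> 1) = int (durfee_width m \<alpha>) + m + 1 + Max (shift_set m \<alpha>)"
    by (auto simp: V_def)
  then obtain g where g: "1 \<le> g" "m = int g - 1 - int (part \<alpha> g)" by (auto simp: rank_set_iff)
  define h where "h = nat (Max (shift_set m \<alpha>))"
  have h: "Max (shift_set m \<alpha>) = int h"
    using Max_shift_set_nonneg[OF \<alpha> g] by (simp add: h_def)
  have k: "part \<beta> 1 = g + h"
    using \<beta>1 g(2) unfolding h durfee_width_eq[OF \<alpha> g] by linarith
  \<comment> \<open>An empty \<open>\<beta>\<close> would have first part 0, but
    \<open>g + h \<ge> 1\<close>. Hence the number \<open>r\<close> of copies is positive.\<close>
  with g have ne: "\<beta> \<noteq> []" by (auto simp: part_def)
  with k have "hd \<beta> = g + h" by (cases \<beta>) (auto simp: part_def)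
  with ne \<beta> have "\<forall>x\<in>set \<beta>. x = g + h" by (metis hd_in_set)
  then have rep: "\<beta> = replicate (length \<beta>) (g + h)"
    by (simp add: replicate_length_same)
  then have "sum_list \<beta> = length \<beta> * (g + h)"
    by (metis sum_list_replicate of_nat_id)
  with rep n ne g h \<alpha> Max_shift_set_iff[OF \<alpha> g, of h]
  show "is_partition \<alpha> \<and> ?R"
    by (intro conjI exI[of _ g] exI[of _ h] exI[of _ "length \<beta>"]) (auto simp: Suc_le_eq)
next
  assume "is_partition \<alpha> \<and> ?R"
  then obtain g h r where \<alpha>: "is_partition \<alpha>" and g: "1 \<le> g" "m = int g - 1 - int (part \<alpha> g)"
    and r: "1 \<le> r" and h: "h \<le> part \<alpha> (g + h)" "part \<alpha> (Suc (g + h)) \<le> h"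
    and \<beta>: "\<beta> = replicate r (g + h)" and n: "sum_list \<alpha> + r * (g + h) = n" by blast
  have "Max (shift_set m \<alpha>) = int h" using Max_shift_set_iff[OF \<alpha> g] h by blast
  moreover have "m \<in> rank_set \<alpha>" using g rank_set_iff by blast
  moreover have "is_partition \<beta>"
    using g by (auto simp: \<beta> is_partition_def sorted_wrt_iff_nth_less)
  moreover have "part \<beta> 1 = g + h" using r by (simp add: \<beta> part_def)
  ultimately show ?L
    using \<alpha> n g durfee_width_eq[OF \<alpha> g] by (simp add: V_def \<beta> sum_list_replicate)
qed

text \<open>Equality of the two conjugate parts, with common value \<open>k\<close>, says that every
  row of length at least \<open>s\<close> reaches \<open>t\<close>, which is visible at rows
  \<open>k\<close> and \<open>k + 1\<close>. The Durfee condition turns into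
  \<open>s \<le> k\<close>, since \<open>s \<le> part \<mu> s\<close> and
  \<open>s \<le> conj_part \<mu> s\<close> are equivalent.\<close>

lemma doubly_marked_iff:
  "doubly_marked n (\<mu>, s, t) \<longleftrightarrow>
    is_partition \<mu> \<and> sum_list \<mu> = n \<and> 1 \<le> s \<and> s \<le> t \<and>
    (\<exists>k\<ge>s. t \<le> part \<mu> k \<and> part \<mu> (Suc k) < s)"
  (is "?L \<longleftrightarrow> ?P \<and> ?R")
proof
  assume ?L
  then have \<mu>: "is_partition \<mu>" and st: "sum_list \<mu> = n" "1 \<le> s" "s \<le> durfee \<mu>" "s \<le> t"
    "conj_part \<mu> s = conj_part \<mu> t" by (auto simp: doubly_marked_def)
  let ?k = "conj_part \<mu> s"
  have "s \<le> ?k" using le_conj_part_iff[OF \<mu>, of s s] le_durfee_iff[OF \<mu>, of s] st(2,3) by blast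
  moreover have "t \<le> part \<mu> ?k" using le_conj_part_iff[OF \<mu>, of t ?k] st \<open>s \<le> ?k\<close> by simp
  moreover have "part \<mu> (Suc ?k) < s" using le_conj_part_iff[OF \<mu>, of s "Suc ?k"] st by simp
  ultimately show "?P \<and> ?R" using \<mu> st by blast
next
  assume "?P \<and> ?R"
  then obtain k where \<mu>: "is_partition \<mu>" and st: "sum_list \<mu> = n" "1 \<le> s" "s \<le> t"
    and k: "s \<le> k" "t \<le> part \<mu> k" "part \<mu> (Suc k) < s" by blast
  have "conj_part \<mu> s = k" "conj_part \<mu> t = k"
    using st k by (auto intro!: conj_part_eqI \<mu>)
  moreover have "s \<le> durfee \<mu>"
    using le_durfee_iff[OF \<mu> st(2)] part_antimono[OF \<mu> st(2) k(1)] st k by simp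
  moreover have "t \<le> part \<mu> 1"
    using part_antimono[OF \<mu>, of 1 k] st k by simp
  ultimately show ?L using \<mu> st by (simp add: doubly_marked_def)
qed

text \<open>The substitution is \<open>s = h + 1\<close>, \<open>t = h + r\<close>,
  \<open>k = g + h\<close>, chosen to match the parameters of \<open>V_iff\<close>; the term
  \<open>r\<close> in the crank comes from \<open>t - s = r - 1\<close>.\<close>

lemma Q_iff:
  "(\<mu>, s, t) \<in> Q m n \<longleftrightarrow>
    is_partition \<mu> \<and> sum_list \<mu> = n \<and>
    (\<exists>g h r. 1 \<le> g \<and> 1 \<le> r \<and> s = Suc h \<and> t = h + r \<and>
      m = int g - 1 + int r - int (part \<mu> g) \<and>
      h + r \<le> part \<mu> (g + h) \<and> part \<mu> (Suc (g + h)) \<le> h)"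
  (is "?L \<longleftrightarrow> ?P \<and> ?S \<and> ?R")
proof
  assume L: ?L
  then obtain k where \<mu>: "is_partition \<mu>" and st: "sum_list \<mu> = n" "1 \<le> s" "s \<le> t"
    and k: "s \<le> k" "t \<le> part \<mu> k" "part \<mu> (Suc k) < s"
    by (auto simp: Q_def doubly_marked_iff)
  have "conj_part \<mu> s = k" using st k by (auto intro!: conj_part_eqI \<mu>)
  with L have "m = int (k - s + 1) - int (part \<mu> (k - s + 1)) + int t - int s"
    by (simp add: Q_def spt_crank_def Let_def)
  with \<mu> st k show "?P \<and> ?S \<and> ?R"
    by (intro conjI exI[of _ "k - s + 1"] exI[of _ "s - 1"] exI[of _ "t - s + 1"]) auto
next
  assume "?P \<and> ?S \<and> ?R"
  then obtain g h r where \<mu>: "is_partition \<mu>" "sum_list \<mu> = n"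
    and st: "1 \<le> g" "1 \<le> r" "s = Suc h" "t = h + r"
    and m: "m = int g - 1 + int r - int (part \<mu> g)"
    and k: "h + r \<le> part \<mu> (g + h)" "part \<mu> (Suc (g + h)) \<le> h" by blast
  have "conj_part \<mu> s = g + h" using st k by (auto intro!: conj_part_eqI \<mu>)
  then have "spt_crank (\<mu>, s, t) = m" using st m by (simp add: spt_crank_def Let_def)
  moreover have "doubly_marked n (\<mu>, s, t)"
    unfolding doubly_marked_iff using \<mu> st k by (auto intro!: exI[of _ "g + h"])
  ultimately show ?L by (simp add: Q_def)
qed

section \<open>Effect of psi: removing r columns of height k\<close>

lemma psi_props:
  assumes \<mu>: "is_partition \<mu>" and "1 \<le> k" "1 \<le> r"
    and k: "h + r \<le> part \<mu> k" "part \<mu> (Suc k) \<le> h"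
    and psi: "psi (\<mu>, Suc h, h + r) = (\<alpha>, \<beta>)"
  shows "\<beta> = replicate r k"
    and "is_partition \<alpha>"
    and "\<And>i. 1 \<le> i \<Longrightarrow> part \<mu> i = part \<alpha> i + (if i \<le> k then r else 0)"
    and "sum_list \<mu> = sum_list \<alpha> + r * k"
proof -
  \<comment> \<open>No row ends strictly between the marks: row \<open>k\<close> reaches
    \<open>h + r\<close> and row \<open>k + 1\<close> stops at \<open>h\<close> or earlier. So all
    the columns collected in \<open>\<beta>\<close> have height \<open>k\<close>.\<close>
  have conj: "conj_part \<mu> x = k" if "Suc h \<le> x" "x \<le> h + r" for x
    using that assms by (intro conj_part_eqI) auto
  have kl: "k \<le> length \<mu>" using part_pos_iff[OF \<mu> assms(2)] assms by simp
  define f where "f i = (if i \<le> k then part \<mu> i - r else part \<mu> i)" for i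
  have ge: "h + r \<le> part \<mu> i" if "1 \<le> i" "i \<le> k" for i
    using part_antimono[OF \<mu> that] k by simp
  have le: "part \<mu> i \<le> h" if "k < i" for i
    using part_antimono[OF \<mu>, of "Suc k" i] that k by simp
  \<comment> \<open>The only critical place is the boundary at \<open>k\<close>: the shortened rows
    keep length at least \<open>h\<close>, the later rows have length at most
    \<open>h\<close>.\<close>
  have anti: "f i' \<le> f i" if "1 \<le> i" "i \<le> i'" for i i'
    using part_antimono[OF \<mu> that] ge[of i] ge[of i'] le[of i'] that by (auto simp: f_def)
  have upt: "[1..<Suc (length \<mu>)] = [1..<Suc k] @ [Suc k..<Suc (length \<mu>)]"
    using kl assms(2) upt_add_eq_append[of 1 "Suc k" "length \<mu> - k"] by simp
  \<comment> \<open>The truncated expression equals \<open>part \<mu> i - r\<close> only because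
    these rows have length at least \<open>h + r\<close>.\<close>
  have map1: "map (\<lambda>i. part \<mu> i - (h + r) + Suc h - 1) [1..<Suc k] = map f [1..<Suc k]"
  proof (intro map_cong refl)
    fix i assume "i \<in> set [1..<Suc k]"
    then have "1 \<le> i" "i \<le> k" by auto
    with ge[of i] show "part \<mu> i - (h + r) + Suc h - 1 = f i" by (simp add: f_def)
  qed
  have map2: "map (part \<mu>) [Suc k..<Suc (length \<mu>)] = map f [Suc k..<Suc (length \<mu>)]"
    by (intro map_cong) (auto simp: f_def simp del: upt_Suc)
  have "conj_part \<mu> (Suc h) = k" using conj assms(3) by simp
  then have \<alpha>: "\<alpha> = parts_of f (length \<mu>)"
    using psi unfolding psi_def parts_of_def upt map_append prod.case
    by (simp only: map1 map2 prod.inject)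
  have "\<beta> = map (conj_part \<mu>) [Suc h..<Suc (h + r)]"
    using psi by (simp add: psi_def del: upt_Suc)
  also have "\<dots> = map (\<lambda>_. k) [Suc h..<Suc (h + r)]"
    using conj by (intro map_cong) (auto simp del: upt_Suc)
  finally show "\<beta> = replicate r k" by (simp add: map_replicate_const del: upt_Suc)
  show \<alpha>p: "is_partition \<alpha>" unfolding \<alpha> by (rule is_partition_parts_of) (rule anti)
  have part\<alpha>: "part \<alpha> i = (if 1 \<le> i \<and> i \<le> length \<mu> then f i else 0)" for i
    unfolding \<alpha> by (rule part_parts_of) (rule anti)
  \<comment> \<open>Stated additively, this avoids truncated subtraction and determines either
    partition from the other.\<close>
  show part: "part \<mu> i = part \<alpha> i + (if i \<le> k then r else 0)" if "1 \<le> i" for i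
    using that ge[of i] kl part_pos_iff[OF \<mu> that] by (auto simp: part\<alpha> f_def)
  \<comment> \<open>The last part of \<open>\<alpha>\<close> is positive, while
    \<open>part \<alpha>\<close> vanishes beyond \<open>length \<mu>\<close>.\<close>
  have "length \<alpha> \<le> length \<mu>"
    using part_pos_iff[OF \<alpha>p, of "length \<alpha>"] part\<alpha>[of "length \<alpha>"]
    by (cases "length \<alpha>") (auto split: if_splits)
  then have "sum_list \<alpha> = (\<Sum>i=1..length \<mu>. part \<alpha> i)" by (rule sum_list_eq_sum_part)
  moreover have "sum_list \<mu> = (\<Sum>i=1..length \<mu>. part \<alpha> i + (if i \<le> k then r else 0))"
    unfolding sum_list_eq_sum_part[OF order_refl] by (intro sum.cong) (auto simp: part)
  moreover have "(\<Sum>i=1..length \<mu>. if i \<le> k then r else 0) = (\<Sum>i=1..k. r)"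
    using kl by (intro sum.mono_neutral_cong_right) auto
  ultimately show "sum_list \<mu> = sum_list \<alpha> + r * k" by (simp add: sum.distrib)
qed

section \<open>Bijectivity of psi\<close>

lemma psi_mem_V:
  assumes "x \<in> Q m n"
  shows "psi x \<in> V m n"
proof -
  obtain \<mu> s t where x: "x = (\<mu>, s, t)" by (cases x)
  obtain \<alpha> \<beta> where ab: "psi x = (\<alpha>, \<beta>)" by (cases "psi x")
  from assms obtain g h r where \<mu>: "is_partition \<mu>" "sum_list \<mu> = n"
    and st: "1 \<le> g" "1 \<le> r" "s = Suc h" "t = h + r"
    and m: "m = int g - 1 + int r - int (part \<mu> g)"
    and k: "h + r \<le> part \<mu> (g + h)" "part \<mu> (Suc (g + h)) \<le> h" unfolding x Q_iff by blast
  have "1 \<le> g + h" "psi (\<mu>, Suc h, h + r) = (\<alpha>, \<beta>)" using st x ab by auto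
  note props = psi_props[OF \<mu>(1) this(1) st(2) k this(2)]
  \<comment> \<open>Row \<open>g\<close> is among the first \<open>g + h\<close> rows and loses
    \<open>r\<close>, which cancels the \<open>r\<close> in the crank; the same \<open>g\<close>,
    \<open>h\<close>, \<open>r\<close> therefore serve for \<open>V_iff\<close>.\<close>
  from props(1,2,4) props(3)[of g] props(3)[of "g + h"] props(3)[of "Suc (g + h)"] st m k \<mu>
  show ?thesis unfolding ab V_iff
    by (intro conjI exI[of _ g] exI[of _ h] exI[of _ r]) auto
qed

text \<open>The length and the repeated entry of \<open>\<beta>\<close> give \<open>r\<close> and
  \<open>g + h\<close>; the crank \<open>m\<close> then gives \<open>g\<close> from
  \<open>\<alpha>\<close>, hence \<open>h\<close>, and putting the columns back gives
  \<open>\<mu>\<close>.\<close>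

lemma psi_inj_on: "inj_on psi (Q m n)"
proof (rule inj_onI)
  fix x x' assume x: "x \<in> Q m n" and x': "x' \<in> Q m n" and eq: "psi x = psi x'"
  obtain \<mu> s t where xx: "x = (\<mu>, s, t)" by (cases x)
  obtain \<mu>' s' t' where xx': "x' = (\<mu>', s', t')" by (cases x')
  obtain \<alpha> \<beta> where ab: "psi x = (\<alpha>, \<beta>)" by (cases "psi x")
  from x obtain g h r where \<mu>: "is_partition \<mu>"
    and st: "1 \<le> g" "1 \<le> r" "s = Suc h" "t = h + r"
    and m: "m = int g - 1 + int r - int (part \<mu> g)"
    and k: "h + r \<le> part \<mu> (g + h)" "part \<mu> (Suc (g + h)) \<le> h" unfolding xx Q_iff by blast
  from x' obtain g' h' r' where \<mu>': "is_partition \<mu>'"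
    and st': "1 \<le> g'" "1 \<le> r'" "s' = Suc h'" "t' = h' + r'"
    and m': "m = int g' - 1 + int r' - int (part \<mu>' g')"
    and k': "h' + r' \<le> part \<mu>' (g' + h')" "part \<mu>' (Suc (g' + h')) \<le> h'"
    unfolding xx' Q_iff by blast
  have "1 \<le> g + h" "psi (\<mu>, Suc h, h + r) = (\<alpha>, \<beta>)" using st xx ab by auto
  note props = psi_props[OF \<mu> this(1) st(2) k this(2)]
  have "1 \<le> g' + h'" "psi (\<mu>', Suc h', h' + r') = (\<alpha>, \<beta>)" using st' xx' ab eq by auto
  note props' = psi_props[OF \<mu>' this(1) st'(2) k' this(2)]
  have r: "r = r'" and gh: "g + h = g' + h'"
    using props(1) props'(1) st(2) by (auto simp: replicate_eq_replicate)
  have "int g - 1 - int (part \<alpha> g) = int g' - 1 - int (part \<alpha> g')"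
    using m m' props(3)[OF st(1)] props'(3)[OF st'(1)] by simp
  then have "g = g'" using crank_index_unique props(2) st(1) st'(1) by blast
  moreover have "\<mu> = \<mu>'"
    using props(3) props'(3) r gh by (intro partition_eqI \<mu> \<mu>') auto
  ultimately show "x = x'" using r gh st st' xx xx' by simp
qed

text \<open>The preimage arises by inserting \<open>r\<close> columns of height \<open>g + h\<close>
  into \<open>\<alpha>\<close>; applying \<open>psi_props\<close> to it shows that
  \<open>psi\<close> removes exactly these columns.\<close>

lemma V_subset_psi_image: "V m n \<subseteq> psi ` Q m n"
proof
  fix y assume y: "y \<in> V m n"
  obtain \<alpha> \<beta> where ab: "y = (\<alpha>, \<beta>)" by (cases y)
  from y obtain g h r where \<alpha>: "is_partition \<alpha>" and g: "1 \<le> g" "1 \<le> r"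
    and m: "m = int g - 1 - int (part \<alpha> g)"
    and h: "h \<le> part \<alpha> (g + h)" "part \<alpha> (Suc (g + h)) \<le> h"
    and \<beta>: "\<beta> = replicate r (g + h)" and n: "sum_list \<alpha> + r * (g + h) = n"
    unfolding ab V_iff by blast
  define f where "f i = part \<alpha> i + (if i \<le> g + h then r else 0)" for i
  \<comment> \<open>The bound exceeds neither summand's needs by harm: it covers all rows of
    \<open>\<alpha>\<close> and all \<open>g + h\<close> lengthened rows. When \<open>h = 0\<close>
    the latter may extend past the end of \<open>\<alpha>\<close>, giving new rows of length
    \<open>r\<close>.\<close>
  define \<mu> where "\<mu> = parts_of f (length \<alpha> + (g + h))"
  have anti: "f i' \<le> f i" if "1 \<le> i" "i \<le> i'" for i i'
    using part_antimono[OF \<alpha> that] that by (auto simp: f_def)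
  have \<mu>: "is_partition \<mu>" unfolding \<mu>_def by (rule is_partition_parts_of) (rule anti)
  have "part \<mu> i = (if 1 \<le> i \<and> i \<le> length \<alpha> + (g + h) then f i else 0)" for i
    unfolding \<mu>_def by (rule part_parts_of) (rule anti)
  then have part: "part \<mu> i = part \<alpha> i + (if i \<le> g + h then r else 0)" if "1 \<le> i" for i
    using that by (simp add: f_def) (simp add: part_def)
  have k: "h + r \<le> part \<mu> (g + h)" "part \<mu> (Suc (g + h)) \<le> h"
    using part[of "g + h"] part[of "Suc (g + h)"] g h by auto
  obtain \<alpha>' \<beta>' where psi: "psi (\<mu>, Suc h, h + r) = (\<alpha>', \<beta>')"
    by (cases "psi (\<mu>, Suc h, h + r)")
  have "1 \<le> g + h" using g by simp
  note props = psi_props[OF \<mu> this g(2) k psi]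
  have "\<alpha>' = \<alpha>" using props(3) part by (intro partition_eqI props(2) \<alpha>) auto
  with props(1) \<beta> psi ab have "psi (\<mu>, Suc h, h + r) = y" by simp
  moreover have "(\<mu>, Suc h, h + r) \<in> Q m n"
    unfolding Q_iff using \<mu> props(4) \<open>\<alpha>' = \<alpha>\<close> n g m k part[of g]
    by (intro conjI exI[of _ g] exI[of _ h] exI[of _ r]) auto
  ultimately show "y \<in> psi ` Q m n" by force
qed

theorem theorem2p7:
  fixes m :: int and n :: nat
  assumes "n > 0"
  shows "bij_betw psi (Q m n) (V m n)"
  unfolding bij_betw_def using psi_inj_on psi_mem_V V_subset_psi_image by blast

end
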